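(* Let $G$ be a cograph, and let $C_1,\ldots,C_r$ and $D_1,\ldots,D_s$ (with $r,s\ge 0$) be all the duplication classes and all the coduplication classes of $G$, respectively. Then $$\operatorname{mult}(0,G)=\sum_{i=1}^r(|C_i|-1),\qquad \operatorname{mult}(-1,G)=\sum_{i=1}^s(|D_i|-1).$$ In particular, if $G$ has no pair of distinct vertices $u,v$ with $N(u)=N(v)$, then $0$ is not an eigenvalue of $G$, and if $G$ has no pair of distinct vertices $u,v$ with $N[u]=N[v]$, then $-1$ is not an eigenvalue of $G$.
   Context: A cograph is a finite simple graph that contains no induced subgraph isomorphic to the path on $4$ vertices. Eigenvalues of a graph are those of its adjacency matrix, and $\operatorname{mult}(\lambda,G)$ denotes the multiplicity of $\lambda$ as an eigenvalue of $G$ (zero if $\lambda$ is not an eigenvalue). For a vertex $v$, $N(v)$ is its open neighborhood and $N[v]=N(v)\cup\{v\}$ its closed neighborhood. A duplication class of $G$ is a subset $S\subseteq V(G)$ with $|S|>1$ such that $N(u)=N(v)$ for all $u,v\in S$, and $S$ is maximal with this property; a coduplication class is defined analogously with $N[u]=N[v]$.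
   Formalization: The two claims about the eigenvalue 0 are proved only for cographs in which every vertex has a nonempty open neighborhood; with an isolated vertex the formula fails (e.g. the one-vertex graph has mult(0)=1 but no duplication class). *)

theory Defs
  imports
    "Graph_Theory.Graph_Theory"
    "Jordan_Normal_Form.Char_Poly"
begin

text \<open>
  A finite simple graph is a \<^locale>\<open>pair_graph\<close>: a finite, loop-free digraph whose arc set is a
  symmetric relation, so an edge \<open>uv\<close> is the pair of arcs \<open>(u, v)\<close>, \<open>(v, u)\<close>.
\<close>

definition path4 :: "nat pair_pre_digraph" where
  "path4 = \<lparr> pverts = {0, 1, 2, 3},
             parcs = {(0, 1), (1, 0), (1, 2), (2, 1), (2, 3), (3, 2)} \<rparr>"

definition cograph :: "'a pair_pre_digraph \<Rightarrow> bool" where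
  "cograph G \<longleftrightarrow> pair_graph G \<and>
     \<not> (\<exists>H. induced_subgraph H (with_proj G) \<and> digraph_iso (with_proj path4) H)"

definition open_nbhd :: "'a pair_pre_digraph \<Rightarrow> 'a \<Rightarrow> 'a set" where
  "open_nbhd G v = {u \<in> pverts G. (v, u) \<in> parcs G}"

definition closed_nbhd :: "'a pair_pre_digraph \<Rightarrow> 'a \<Rightarrow> 'a set" where
  "closed_nbhd G v = open_nbhd G v \<union> {v}"

definition twin_set :: "('a \<Rightarrow> 'a set) \<Rightarrow> 'a pair_pre_digraph \<Rightarrow> 'a set \<Rightarrow> bool" where
  "twin_set N G S \<longleftrightarrow> S \<subseteq> pverts G \<and> card S > 1 \<and> (\<forall>u\<in>S. \<forall>v\<in>S. N u = N v)"

definition duplication_class :: "'a pair_pre_digraph \<Rightarrow> 'a set \<Rightarrow> bool" where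
  "duplication_class G S \<longleftrightarrow> twin_set (open_nbhd G) G S \<and>
     (\<forall>T. twin_set (open_nbhd G) G T \<and> S \<subseteq> T \<longrightarrow> T = S)"

definition coduplication_class :: "'a pair_pre_digraph \<Rightarrow> 'a set \<Rightarrow> bool" where
  "coduplication_class G S \<longleftrightarrow> twin_set (closed_nbhd G) G S \<and>
     (\<forall>T. twin_set (closed_nbhd G) G T \<and> S \<subseteq> T \<longrightarrow> T = S)"

text \<open>The adjacency matrix with respect to the enumeration \<open>vs\<close> of the vertices.\<close>

definition adjacency_mat :: "'a pair_pre_digraph \<Rightarrow> 'a list \<Rightarrow> real mat" where
  "adjacency_mat G vs = mat (length vs) (length vs)
     (\<lambda>(i, j). if (vs ! i, vs ! j) \<in> parcs G then 1 else 0)"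

text \<open>
  Algebraic multiplicity. Adjacency matrices of graphs are real symmetric, so for them it equals the
  dimension of the eigenspace and nothing is lost by working over the reals.
\<close>

definition eig_mult :: "real \<Rightarrow> real mat \<Rightarrow> nat" where
  "eig_mult x A = Polynomial.order x (char_poly A)"

end

theory Submission
  imports Defs
begin

text \<open>
  Both eigenvalues are treated at once by allowing loops: \<open>A\<close> and \<open>A + I\<close> are the 0/1 matrices \<open>M\<close> of
  the loop-free and of the reflexive version of the same graph, and complementation \<open>M \<mapsto> J - M\<close>
  exchanges the two kinds. If \<open>M x = c 1\<close> and \<open>\<sigma>\<close> is the sum of \<open>x\<close>, then \<open>(J - M) x = (\<sigma> - c) 1\<close>, so the
  inequality \<open>c (\<sigma> - c) \<ge> 0\<close> is invariant under complementation. It passes to disjoint unions in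
  the stronger form \<open>c (\<sigma> - c) \<ge> c\<^sup>2\<close>, since \<open>\<sigma>\<close> is additive there and \<open>c\<close> is shared. As a \<open>P\<^sub>4\<close>-free
  graph or its complement is disconnected, this induction reaches all cographs, and carrying along
  the cases \<open>c = 0\<close> and \<open>c = \<sigma>\<close> shows that every kernel vector of \<open>M\<close> sums to zero on each twin class
  with nonempty neighbourhood.

  For the multiplicity, factor \<open>M = E F\<close> through the set of \<open>k\<close> distinct neighbourhoods. Sylvester's
  identity compares the characteristic polynomials of \<open>E F\<close> and \<open>F E\<close>, and \<open>F E\<close> is nonsingular by the
  statement on kernel vectors, so the multiplicity is \<open>n - k\<close>.
\<close>

section \<open>Decomposition of graphs without induced four-vertex paths\<close>

definition P4_free :: "'a set \<Rightarrow> ('a \<Rightarrow> 'a \<Rightarrow> bool) \<Rightarrow> bool" where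
  "P4_free V R \<longleftrightarrow> \<not> (\<exists>a\<in>V. \<exists>b\<in>V. \<exists>c\<in>V. \<exists>d\<in>V. distinct [a, b, c, d] \<and>
     R a b \<and> R b c \<and> R c d \<and> \<not> R a c \<and> \<not> R a d \<and> \<not> R b d)"

lemma P4_free_subset: "P4_free V R \<Longrightarrow> W \<subseteq> V \<Longrightarrow> P4_free W R"
  unfolding P4_free_def by blast

text \<open>The four-vertex path is self-complementary: an induced path \<open>a b c d\<close> of
  the complement is the induced path \<open>b d a c\<close> of \<open>R\<close>.\<close>

lemma P4_free_complement:
  assumes "symp R" "P4_free V R"
  shows "P4_free V (\<lambda>u v. \<not> R u v)"
  unfolding P4_free_def
proof (safe, goal_cases)
  case (1 a b c d)
  have "R b d" "R d a" "R a c" "\<not> R b a" "\<not> R b c" "\<not> R d c" "distinct [b, d, a, c]"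
    using 1 sympD[OF assms(1)] by auto
  then show False
    using assms(2) 1(1-4) unfolding P4_free_def by blast
qed

definition splits :: "'a set \<Rightarrow> ('a \<Rightarrow> 'a \<Rightarrow> bool) \<Rightarrow> 'a set \<Rightarrow> 'a set \<Rightarrow> bool" where
  "splits V R A B \<longleftrightarrow> A \<noteq> {} \<and> B \<noteq> {} \<and> A \<inter> B = {} \<and> A \<union> B = V \<and> (\<forall>a\<in>A. \<forall>b\<in>B. \<not> R a b)"

text \<open>Unless \<open>v\<close> is joined to all of \<open>W\<close>, take the component
  \<open>C\<close> of a non-neighbour of \<open>v\<close>. If \<open>v\<close> has no neighbour in
  \<open>C\<close>, or none in the rest \<open>D\<close>, then \<open>R\<close> still splits.
  Otherwise an edge of \<open>C\<close> from a non-neighbour to a neighbour of \<open>v\<close>,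
  followed by \<open>v\<close> and a neighbour in \<open>D\<close>, is an induced path.\<close>

lemma P4_free_insert_split:
  assumes sym: "symp R" and free: "P4_free (insert v W) R" and v: "v \<notin> W"
    and split: "splits W R A B"
  shows "\<exists>A B. splits (insert v W) R A B \<or> splits (insert v W) (\<lambda>u v. \<not> R u v) A B"
proof (cases "\<forall>w\<in>W. R v w")
  case True
  then have "splits (insert v W) (\<lambda>u v. \<not> R u v) {v} W"
    using v split unfolding splits_def by auto
  then show ?thesis by blast
next
  case False
  then obtain w where w: "w \<in> W" "\<not> R v w" by blast
  have R_sym: "R a b = R b a" for a b
    using sympD[OF sym] by blast
  \<comment> \<open>\<open>C\<close> is the component of \<open>w\<close> in \<open>W\<close>; it misses a vertex because \<open>W\<close> is disconnected.\<close>
  define E where "E = {(a, b). a \<in> W \<and> b \<in> W \<and> R a b}"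
  define C where "C = E\<^sup>* `` {w}"
  define D where "D = W - C"
  have C_closed: "b \<in> C" if "a \<in> C" "b \<in> W" "R a b" "a \<in> W" for a b
    using that unfolding C_def E_def by (auto intro: rtrancl_into_rtrancl)
  have wC: "w \<in> C"
    unfolding C_def by simp
  have mem: "z \<in> W \<and> (z \<in> A \<longleftrightarrow> w \<in> A)" if "z \<in> C" for z
  proof -
    have "(w, z) \<in> E\<^sup>*" using that unfolding C_def by simp
    then show ?thesis
    proof (induction rule: rtrancl_induct)
      case base
      show ?case using w by simp
    next
      case (step y z)
      then show ?case
        using split R_sym unfolding E_def splits_def by auto
    qed
  qed
  have "D \<noteq> {}"
  proof
    assume "D = {}"
    then have "W \<subseteq> C" unfolding D_def by blast
    then show False using mem split unfolding splits_def by blast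
  qed
  have noCD: "\<not> R a b" if "a \<in> C" "b \<in> D" for a b
    using that C_closed mem unfolding D_def by blast
  have noDC: "\<not> R b a" if "a \<in> C" "b \<in> D" for a b
    using that noCD R_sym by blast
  have W: "W = C \<union> D" "C \<inter> D = {}"
    using mem unfolding D_def by auto
  consider "\<forall>c\<in>C. \<not> R v c" | "\<forall>d\<in>D. \<not> R v d" | "\<exists>c\<in>C. R v c" "\<exists>d\<in>D. R v d"
    by blast
  then show ?thesis
  proof cases
    case 1
    have "splits (insert v W) R C (insert v D)"
      using 1 noCD W v wC R_sym unfolding splits_def by auto
    then show ?thesis by blast
  next
    case 2
    then have "\<forall>d\<in>D. \<not> R d v" using R_sym by blast
    then have "splits (insert v W) R D (insert v C)"
      using noDC W v \<open>D \<noteq> {}\<close> unfolding splits_def by auto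
    then show ?thesis by blast
  next
    case 3
    obtain d where d: "d \<in> D" "R v d" using 3 by blast
    \<comment> \<open>A walk in \<open>C\<close> from the non-neighbour \<open>w\<close> to a
      neighbour of \<open>v\<close> must cross from non-neighbours to neighbours.\<close>
    have "\<exists>b\<in>C. \<exists>a\<in>C. R b a \<and> \<not> R v b \<and> R v a"
    proof (rule ccontr)
      assume no: "\<not> ?thesis"
      have "\<not> R v z" if "z \<in> C" for z
      proof -
        have "(w, z) \<in> E\<^sup>*" using that unfolding C_def by simp
        then show ?thesis
        proof (induction rule: rtrancl_induct)
          case base
          show ?case using w by simp
        next
          case (step y z)
          moreover have "y \<in> C" "z \<in> C"
            using step.hyps unfolding C_def by (auto intro: rtrancl_into_rtrancl)
          ultimately show ?case
            using no unfolding E_def by blast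
        qed
      qed
      then show False using 3 by blast
    qed
    then obtain a b where ab: "b \<in> C" "a \<in> C" "R b a" "\<not> R v b" "R v a" by blast
    have "distinct [b, a, v, d]"
      using ab d W v by auto
    moreover have "R a v" "\<not> R b v" "\<not> R b d" "\<not> R a d"
      using ab d noCD R_sym by auto
    moreover have "b \<in> insert v W" "a \<in> insert v W" "v \<in> insert v W" "d \<in> insert v W"
      using ab d W by auto
    ultimately have False
      using free ab d unfolding P4_free_def by blast
    then show ?thesis ..
  qed
qed

text \<open>Seinsche's theorem, adding one vertex at a time. If it is the complement of the smaller
  graph that splits, the insertion lemma is applied to the complement.\<close>

lemma P4_free_split:
  assumes "finite V" "symp R" "P4_free V R" "2 \<le> card V"
  shows "\<exists>A B. splits V R A B \<or> splits V (\<lambda>u v. \<not> R u v) A B"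
  using assms
proof (induction V rule: finite_induct)
  case empty
  then show ?case by simp
next
  case (insert v W)
  show ?case
  proof (cases "2 \<le> card W")
    case True
    have "P4_free W R"
      using insert.prems(2) by (rule P4_free_subset) auto
    then obtain A B where "splits W R A B \<or> splits W (\<lambda>u v. \<not> R u v) A B"
      using insert.IH insert.prems True by blast
    then show ?thesis
    proof
      assume "splits W R A B"
      then show ?thesis
        using P4_free_insert_split insert by metis
    next
      assume "splits W (\<lambda>u v. \<not> R u v) A B"
      moreover have "symp (\<lambda>u v. \<not> R u v)"
        using insert.prems(1) by (auto intro!: sympI dest: sympD)
      ultimately show ?thesis
        using P4_free_insert_split[of "\<lambda>u v. \<not> R u v" v W A B]
          P4_free_complement[OF insert.prems(1,2)] insert.hyps by auto
    qed
  next
    case False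
    then have "card W = 1" using insert by simp
    then obtain w where "W = {w}" by (meson card_1_singletonE)
    then have "splits (insert v W) R {v} {w} \<or> splits (insert v W) (\<lambda>u v. \<not> R u v) {v} {w}"
      using insert.hyps unfolding splits_def by auto
    then show ?thesis by blast
  qed
qed

section \<open>Class sums of vectors with constant image\<close>

abbreviation nbhd :: "'a set \<Rightarrow> ('a \<Rightarrow> 'a \<Rightarrow> bool) \<Rightarrow> 'a \<Rightarrow> 'a set" where
  "nbhd V R u \<equiv> {w \<in> V. R u w}"

abbreviation twins :: "'a set \<Rightarrow> ('a \<Rightarrow> 'b) \<Rightarrow> 'a \<Rightarrow> 'a set" where
  "twins V N u \<equiv> {w \<in> V. N w = N u}"

lemma twins_restrict:
  assumes "V = X \<union> Y" "\<And>v. v \<in> X \<Longrightarrow> N v = N' v" "\<And>w. w \<in> Y \<Longrightarrow> N w \<noteq> N u" "u \<in> X"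
  shows "twins V N u = twins X N' u"
  using assms by auto

text \<open>
  The exceptional classes \<open>nbhd V R u = {}\<close> and \<open>nbhd V R u = V\<close> are exchanged by complementation, as are
  the conditions \<open>c = 0\<close> and \<open>c = sum x V\<close>. The predicate fails for \<open>V = {}\<close>, where \<open>c\<close> is unconstrained.
\<close>

definition balanced :: "'a set \<Rightarrow> ('a \<Rightarrow> 'a \<Rightarrow> bool) \<Rightarrow> bool" where
  "balanced V R \<longleftrightarrow> (\<forall>(x :: 'a \<Rightarrow> real) c. (\<forall>v\<in>V. sum x (nbhd V R v) = c) \<longrightarrow>
     0 \<le> c * (sum x V - c) \<and>
     (c = 0 \<longrightarrow> (\<forall>u\<in>V. nbhd V R u \<noteq> {} \<longrightarrow> sum x (twins V (nbhd V R) u) = 0)) \<and>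
     (c = sum x V \<longrightarrow> (\<forall>u\<in>V. nbhd V R u \<noteq> V \<longrightarrow> sum x (twins V (nbhd V R) u) = 0)))"

lemma balanced_complement:
  assumes fin: "finite V" and bal: "balanced V (\<lambda>u v. \<not> R u v)"
  shows "balanced V R"
  unfolding balanced_def
proof (intro allI impI)
  fix x :: "'a \<Rightarrow> real" and c
  assume x: "\<forall>v\<in>V. sum x (nbhd V R v) = c"
  let ?N = "nbhd V R" and ?N' = "nbhd V (\<lambda>u v. \<not> R u v)"
  let ?c = "sum x V - c"
  have N': "?N' v = V - ?N v" for v by auto
  have x': "\<forall>v\<in>V. sum x (?N' v) = ?c"
    unfolding N' using x fin by (auto simp: sum_diff)
  \<comment> \<open>Complementation within \<open>V\<close> is injective on neighbourhoods, so the
    twin classes agree.\<close>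
  have tw: "twins V ?N' u = twins V ?N u" for u by auto
  have emp: "(?N' u \<noteq> {}) = (?N u \<noteq> V)" "(?N' u \<noteq> V) = (?N u \<noteq> {})" for u by auto
  have b: "0 \<le> ?c * (sum x V - ?c)"
    "?c = 0 \<Longrightarrow> u \<in> V \<Longrightarrow> ?N' u \<noteq> {} \<Longrightarrow> sum x (twins V ?N' u) = 0"
    "?c = sum x V \<Longrightarrow> u \<in> V \<Longrightarrow> ?N' u \<noteq> V \<Longrightarrow> sum x (twins V ?N' u) = 0" for u
    using bal[unfolded balanced_def, rule_format, of x ?c] x' by blast+
  show "0 \<le> c * (sum x V - c) \<and>
     (c = 0 \<longrightarrow> (\<forall>u\<in>V. ?N u \<noteq> {} \<longrightarrow> sum x (twins V ?N u) = 0)) \<and>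
     (c = sum x V \<longrightarrow> (\<forall>u\<in>V. ?N u \<noteq> V \<longrightarrow> sum x (twins V ?N u) = 0))"
    using b unfolding tw emp by (simp add: mult.commute)
qed

lemma twins_sum_image:
  assumes "finite V"
  shows "(\<Sum>n\<in>N ` V. sum x {w \<in> V. N w = n}) = sum x V"
  by (rule sum.group) (use assms in auto)

lemma balanced_union:
  assumes fin: "finite V" and sym: "symp R" and split: "splits V R A B"
    and A: "balanced A R" and B: "balanced B R"
  shows "balanced V R"
  unfolding balanced_def
proof (intro allI impI)
  fix x :: "'a \<Rightarrow> real" and c
  let ?N = "nbhd V R"
  assume x: "\<forall>v\<in>V. sum x (?N v) = c"
  have V: "V = A \<union> B" and disj: "A \<inter> B = {}" and noAB: "\<And>a b. a \<in> A \<Longrightarrow> b \<in> B \<Longrightarrow> \<not> R a b"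
    and noBA: "\<And>a b. a \<in> A \<Longrightarrow> b \<in> B \<Longrightarrow> \<not> R b a"
    using split sympD[OF sym] unfolding splits_def by blast+
  have NA: "?N v = nbhd A R v" if "v \<in> A" for v using that V noAB by auto
  have NB: "?N v = nbhd B R v" if "v \<in> B" for v using that V noBA by auto
  have xA: "\<forall>v\<in>A. sum x (nbhd A R v) = c" using x NA V by (metis UnI1)
  have xB: "\<forall>v\<in>B. sum x (nbhd B R v) = c" using x NB V by (metis UnI2)
  have sum: "sum x V = sum x A + sum x B"
    using V disj fin by (simp add: sum.union_disjoint)
  have "0 \<le> c * (sum x A - c)" "0 \<le> c * (sum x B - c)"
    using A[unfolded balanced_def, rule_format, of x c] xA
      B[unfolded balanced_def, rule_format, of x c] xB by simp_all
  then have strong: "c\<^sup>2 \<le> c * (sum x V - c)"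
    unfolding sum by (simp add: algebra_simps power2_eq_square)
  \<comment> \<open>A nonempty neighbourhood lies inside one part, which therefore contains the
    whole twin class.\<close>
  have twins_part: "twins V ?N u = twins X (nbhd X R) u"
    if XY: "V = X \<union> Y" "X \<inter> Y = {}" and NX: "\<And>v. v \<in> X \<Longrightarrow> ?N v = nbhd X R v"
      and NY: "\<And>v. v \<in> Y \<Longrightarrow> ?N v = nbhd Y R v" and u: "u \<in> X" "?N u \<noteq> {}" for X Y u
  proof -
    obtain z where z: "z \<in> ?N u" using u by blast
    then have "z \<in> X" using NX[OF u(1)] by blast
    then have "?N w \<noteq> ?N u" if "w \<in> Y" for w
      using NY[OF that] z XY(2) by blast
    from twins_restrict[of V X Y ?N "nbhd X R" u, OF XY(1) NX this u(1)] show ?thesis .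
  qed
  have zero: "sum x (twins V ?N u) = 0" if c: "c = 0" and u: "u \<in> V" "?N u \<noteq> {}" for u
  proof (cases "u \<in> A")
    case True
    have "sum x (twins A (nbhd A R) u) = 0"
      using A[unfolded balanced_def, rule_format, of x c] xA c True u(2) NA[OF True] by simp
    then show ?thesis
      using twins_part[of A B u, OF V disj NA NB True u(2)] by simp
  next
    case False
    have V': "V = B \<union> A" "B \<inter> A = {}" using V disj by auto
    from False have B_u: "u \<in> B" using u V by auto
    have "sum x (twins B (nbhd B R) u) = 0"
      using B[unfolded balanced_def, rule_format, of x c] xB c B_u u(2) NB[OF B_u] by simp
    then show ?thesis
      using twins_part[of B A u, OF V' NB NA B_u u(2)] by simp
  qed
  have full: "sum x (twins V ?N u) = 0" if c: "c = sum x V" and u: "u \<in> V" for u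
  proof -
    \<comment> \<open>With \<open>c\<close> equal to the full sum, the right side of
      \<open>strong\<close> vanishes.\<close>
    have c0: "c = 0" using strong c by simp
    show ?thesis
    proof (cases "?N u = {}")
      case False
      then show ?thesis using zero c0 u by blast
    next
      case True
      \<comment> \<open>The isolated vertices escape \<open>zero\<close>. Their class sum is what
        remains of the total, here 0, after all other classes have contributed zero.\<close>
      have "sum x V = (\<Sum>n\<in>?N ` V. sum x {w \<in> V. ?N w = n})"
        using twins_sum_image[OF fin, of x ?N] by simp
      also have "\<dots> = sum x {w \<in> V. ?N w = {}}"
      proof (rule sum.remove[where x = "{}", THEN trans])
        show "finite (?N ` V)" using fin by simp
        show "{} \<in> ?N ` V" using True u by force
        have "(\<Sum>n\<in>?N ` V - {{}}. sum x {w \<in> V. ?N w = n}) = 0"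
          using zero c0 by (intro sum.neutral) auto
        then show "sum x {w \<in> V. ?N w = {}} + (\<Sum>n\<in>?N ` V - {{}}. sum x {w \<in> V. ?N w = n}) =
           sum x {w \<in> V. ?N w = {}}" by simp
      qed
      finally have "sum x {w \<in> V. ?N w = {}} = 0" using c c0 by (simp only:)
      then show ?thesis unfolding True .
    qed
  qed
  have "0 \<le> c * (sum x V - c)"
    using strong by (meson order_trans zero_le_power2)
  then show "0 \<le> c * (sum x V - c) \<and>
     (c = 0 \<longrightarrow> (\<forall>u\<in>V. ?N u \<noteq> {} \<longrightarrow> sum x (twins V ?N u) = 0)) \<and>
     (c = sum x V \<longrightarrow> (\<forall>u\<in>V. ?N u \<noteq> V \<longrightarrow> sum x (twins V ?N u) = 0))"
    by (intro conjI impI ballI zero full)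
qed

text \<open>With a loop \<open>c\<close> is the full sum, without one \<open>c = 0\<close>. Either
  way the product vanishes, and one class condition concerns an excluded neighbourhood while the
  other forces \<open>x v = 0\<close>.\<close>

lemma balanced_singleton: "balanced {v} R"
proof -
  have "nbhd {v} R v = (if R v v then {v} else {})" by auto
  then show ?thesis unfolding balanced_def by auto
qed

lemma P4_free_balanced:
  assumes "finite V" "V \<noteq> {}" "symp R" "P4_free V R"
  shows "balanced V R"
  using assms
\<comment> \<open>\<open>R\<close> varies because a split of the complement needs the hypothesis for
  the complemented relation.\<close>
proof (induction V arbitrary: R rule: finite_psubset_induct)
  case (psubset V)
  have union: "balanced V S"
    if S: "symp S" "P4_free V S" "splits V S A B" for S A B
  proof -
    have "A \<subset> V" "B \<subset> V" "A \<noteq> {}" "B \<noteq> {}"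
      using S(3) unfolding splits_def by auto
    then show ?thesis
      using balanced_union[OF psubset.hyps(1) S(1,3)] psubset.IH S P4_free_subset[OF S(2)]
      by (simp add: psubset_imp_subset)
  qed
  show ?case
  proof (cases "2 \<le> card V")
    case True
    then consider A B where "splits V R A B" | A B where "splits V (\<lambda>u v. \<not> R u v) A B"
      using P4_free_split psubset by metis
    then show ?thesis
    proof cases
      case 1
      then show ?thesis using union psubset.prems by blast
    next
      case 2
      moreover have "symp (\<lambda>u v. \<not> R u v)"
        using psubset.prems(2) by (auto intro!: sympI dest: sympD)
      ultimately show ?thesis
        using union P4_free_complement psubset.prems balanced_complement[OF psubset.hyps(1)]
        by blast
    qed
  next
    case False
    then have "card V = 1"
      using psubset.hyps(1) psubset.prems(1)
      by (metis Suc_1 Suc_leI card_gt_0_iff le_neq_implies_less One_nat_def)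
    then show ?thesis
      using balanced_singleton by (metis card_1_singletonE)
  qed
qed

section \<open>Multiplicities from the neighbourhood factorization\<close>

text \<open>Both sides equal \<open>det ?M * y ^ k\<close>: \<open>?L\<close> clears the lower left
  block of \<open>?M\<close>, \<open>?U\<close> the upper right one. Division is avoided so that
  \<open>y\<close> may be a polynomial.\<close>

lemma det_sylvester:
  fixes E F :: "'a :: idom mat"
  assumes E: "E \<in> carrier_mat n k" and F: "F \<in> carrier_mat k n"
  shows "det (y \<cdot>\<^sub>m 1\<^sub>m n - E * F) * y ^ k = y ^ n * det (y \<cdot>\<^sub>m 1\<^sub>m k - F * E)"
proof -
  let ?M = "four_block_mat (y \<cdot>\<^sub>m 1\<^sub>m n) E F (1\<^sub>m k)"
  let ?L = "four_block_mat (1\<^sub>m n) (0\<^sub>m n k) (- F) (1\<^sub>m k)"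
  let ?U = "four_block_mat (1\<^sub>m n) (- E) (0\<^sub>m k n) (y \<cdot>\<^sub>m 1\<^sub>m k)"
  have M: "?M \<in> carrier_mat (n + k) (n + k)" and L: "?L \<in> carrier_mat (n + k) (n + k)"
    and U: "?U \<in> carrier_mat (n + k) (n + k)"
    using E F by auto
  have M_L: "?M * ?L = four_block_mat (y \<cdot>\<^sub>m 1\<^sub>m n - E * F) E (0\<^sub>m k n) (1\<^sub>m k)"
    by (subst mult_four_block_mat[of _ n n _ k _ k _ _ n _ k])
      (use E F in \<open>auto intro!: cong_four_block_mat\<close>)
  have M_U: "?M * ?U = four_block_mat (y \<cdot>\<^sub>m 1\<^sub>m n) (0\<^sub>m n k) F (y \<cdot>\<^sub>m 1\<^sub>m k - F * E)"
    by (subst mult_four_block_mat[of _ n n _ k _ k _ _ n _ k])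
      (use E F in \<open>auto intro!: cong_four_block_mat\<close>)
  have "det ?L = 1" "det ?U = y ^ k"
    using E F by (simp_all add: det_four_block_mat_upper_right_zero[of _ n _ k]
        det_four_block_mat_lower_left_zero[of _ n _ k])
  moreover have "det (?M * ?L) = det ?M * det ?L" "det (?M * ?U) = det ?M * det ?U"
    using det_mult M L U by blast+
  moreover have "det (?M * ?L) = det (y \<cdot>\<^sub>m 1\<^sub>m n - E * F)"
    unfolding M_L using E F
    by (subst det_four_block_mat_lower_left_zero[of _ n _ k]) auto
  moreover have "det (?M * ?U) = y ^ n * det (y \<cdot>\<^sub>m 1\<^sub>m k - F * E)"
    unfolding M_U using E F
    by (subst det_four_block_mat_upper_right_zero[of _ n _ k]) auto
  ultimately show ?thesis by simp
qed

text \<open>The shift moves into the variable, so that Sylvester's identity applies with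
  \<open>y = X - e\<close>.\<close>

lemma char_poly_shift:
  fixes M :: "'a :: comm_ring_1 mat"
  assumes "M \<in> carrier_mat n n"
  shows "char_poly (M + e \<cdot>\<^sub>m 1\<^sub>m n) = det ([:- e, 1:] \<cdot>\<^sub>m 1\<^sub>m n - map_mat (\<lambda>a. [:a:]) M)"
  unfolding char_poly_def char_poly_matrix_def
  by (rule arg_cong[of _ _ det], rule eq_matI) (use assms in auto)

lemma char_poly_sylvester:
  fixes E F :: "'a :: idom mat"
  assumes E: "E \<in> carrier_mat n k" and F: "F \<in> carrier_mat k n"
  shows "char_poly (E * F + e \<cdot>\<^sub>m 1\<^sub>m n) * [:- e, 1:] ^ k =
    [:- e, 1:] ^ n * char_poly (F * E + e \<cdot>\<^sub>m 1\<^sub>m k)"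
proof -
  let ?h = "map_mat (\<lambda>a :: 'a. [:a:])"
  have "?h (E * F) = ?h E * ?h F" "?h (F * E) = ?h F * ?h E"
    using E F map_poly_mult by metis+
  moreover have "?h E \<in> carrier_mat n k" "?h F \<in> carrier_mat k n"
    using E F by auto
  ultimately show ?thesis
    using E F det_sylvester[of "?h E" n k "?h F" "[:- e, 1:]"] by (simp add: char_poly_shift)
qed

text \<open>Since \<open>F * E\<close> is injective, \<open>e\<close> is no root of the
  characteristic polynomial of size \<open>k\<close>. Comparing orders at \<open>e\<close> on both
  sides of Sylvester's identity gives the count.\<close>

lemma order_char_poly_sylvester:
  fixes E F :: "'a :: field mat"
  assumes E: "E \<in> carrier_mat n k" and F: "F \<in> carrier_mat k n"
    and inj: "\<And>z. z \<in> carrier_vec k \<Longrightarrow> F *\<^sub>v (E *\<^sub>v z) = 0\<^sub>v k \<Longrightarrow> z = 0\<^sub>v k"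
  shows "order e (char_poly (E * F + e \<cdot>\<^sub>m 1\<^sub>m n)) + k = n"
proof -
  let ?P = "char_poly (E * F + e \<cdot>\<^sub>m 1\<^sub>m n)" and ?Q = "char_poly (F * E + e \<cdot>\<^sub>m 1\<^sub>m k)"
  have carr: "E * F + e \<cdot>\<^sub>m 1\<^sub>m n \<in> carrier_mat n n" "F * E + e \<cdot>\<^sub>m 1\<^sub>m k \<in> carrier_mat k k"
    using E F by auto
  have nz: "?P \<noteq> 0" "?Q \<noteq> 0"
    using degree_monic_char_poly[OF carr(1)] degree_monic_char_poly[OF carr(2)] by auto
  have char: "char_matrix (F * E + e \<cdot>\<^sub>m 1\<^sub>m k) e = F * E"
    unfolding char_matrix_def by (rule eq_matI) (use E F in auto)
  have "det (F * E) \<noteq> 0"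
  proof
    assume "det (F * E) = 0"
    then obtain z where "z \<in> carrier_vec k" "z \<noteq> 0\<^sub>v k" "F * E *\<^sub>v z = 0\<^sub>v k"
      using det_0_iff_vec_prod_zero[of "F * E" k] E F by auto
    then show False using inj E F by auto
  qed
  then have "poly ?Q e \<noteq> 0"
    using eigenvalue_root_char_poly[OF carr(2), of e] eigenvalue_det[OF carr(2), of e] char by simp
  then have "order e ?Q = 0" by (rule order_0I)
  moreover have "order e (?P * [:- e, 1:] ^ k) = order e ?P + k"
    using nz by (simp add: order_mult order_power_n_n)
  moreover have "order e ([:- e, 1:] ^ n * ?Q) = n + order e ?Q"
    using nz by (simp add: order_mult order_power_n_n)
  ultimately show ?thesis
    using char_poly_sylvester[OF E F, of e] by simp
qed

lemma sum_nth_distinct: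
  assumes "distinct vs"
  shows "(\<Sum>i<length vs. f (vs ! i)) = sum f (set vs)"
  using sum.reindex_bij_betw[OF bij_betw_nth[OF assms refl refl]] .

lemma order_char_poly_twins:
  fixes N :: "'a \<Rightarrow> 'a set" and A :: "real mat"
  assumes vs: "distinct vs"
    and A: "A \<in> carrier_mat (length vs) (length vs)"
    and A_nth: "\<And>i j. i < length vs \<Longrightarrow> j < length vs \<Longrightarrow>
      A $$ (i, j) = of_bool (vs ! j \<in> N (vs ! i)) + (if i = j then e else 0)"
    and N: "\<And>v. v \<in> set vs \<Longrightarrow> N v \<subseteq> set vs"
    and ker: "\<And>x :: 'a \<Rightarrow> real. \<forall>v\<in>set vs. sum x (N v) = 0 \<Longrightarrow>
      \<forall>u\<in>set vs. sum x {w \<in> set vs. N w = N u} = 0"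
  shows "order e (char_poly A) + card (N ` set vs) = length vs"
proof -
  obtain ns where ns: "set ns = N ` set vs" "distinct ns"
    using finite_distinct_list[of "N ` set vs"] by auto
  define n k where "n = length vs" and "k = length ns"
  have k: "k = card (N ` set vs)"
    using ns distinct_card unfolding k_def by metis
  \<comment> \<open>Row \<open>i\<close> of \<open>E\<close> selects the neighbourhood of vertex
    \<open>i\<close>; the rows of \<open>F\<close> are the neighbourhoods, each listed once.\<close>
  define E where "E = mat n k (\<lambda>(i, a). of_bool (N (vs ! i) = ns ! a) :: real)"
  define F where "F = mat k n (\<lambda>(a, j). of_bool (vs ! j \<in> ns ! a) :: real)"
  have E: "E \<in> carrier_mat n k" and F: "F \<in> carrier_mat k n"
    unfolding E_def F_def by auto
  have pick: "(\<Sum>a<k. of_bool (N v = ns ! a) * g (ns ! a)) = (g (N v) :: real)"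
    if "v \<in> set vs" for v and g
  proof -
    have "(\<Sum>a<k. of_bool (N v = ns ! a) * g (ns ! a)) = (\<Sum>m\<in>N ` set vs. of_bool (N v = m) * g m)"
      using sum_nth_distinct[OF ns(2), of "\<lambda>m. of_bool (N v = m) * g m"] ns(1) unfolding k_def by simp
    also have "\<dots> = g (N v)"
      using that by (subst sum.remove[of _ "N v"]) (auto intro!: sum.neutral)
    finally show ?thesis .
  qed
  have EF: "E * F + e \<cdot>\<^sub>m 1\<^sub>m n = A"
  proof (rule eq_matI)
    fix i j assume "i < dim_row A" "j < dim_col A"
    then have ij: "i < n" "j < n" using A n_def by auto
    have "(E * F) $$ (i, j) = (\<Sum>a<k. of_bool (N (vs ! i) = ns ! a) * of_bool (vs ! j \<in> ns ! a))"
      using ij by (simp add: E_def F_def scalar_prod_def lessThan_atLeast0)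
    also have "\<dots> = of_bool (vs ! j \<in> N (vs ! i))"
      using pick[of "vs ! i" "\<lambda>m. of_bool (vs ! j \<in> m)"] ij unfolding n_def by simp
    finally show "(E * F + e \<cdot>\<^sub>m 1\<^sub>m n) $$ (i, j) = A $$ (i, j)"
      using A_nth[of i j] ij E F n_def by auto
  qed (use A E F n_def in auto)
  have "z = 0\<^sub>v k" if z: "z \<in> carrier_vec k" and FEz: "F *\<^sub>v (E *\<^sub>v z) = 0\<^sub>v k" for z
  proof -
    \<comment> \<open>\<open>x\<close> is \<open>E z\<close> read as a function on vertices: on each
      twin class it is constantly an entry of \<open>z\<close>, and \<open>F\<close> sums it over
      neighbourhoods.\<close>
    define x where "x v = (\<Sum>a<k. of_bool (N v = ns ! a) * z $ a)" for v
    have x_nth: "(E *\<^sub>v z) $ i = x (vs ! i)" if "i < n" for i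
      using that z by (simp add: E_def x_def scalar_prod_def lessThan_atLeast0)
    have x_class: "x v = z $ a" if "N v = ns ! a" "a < k" for v a
    proof -
      have "x v = (\<Sum>b<k. if b = a then z $ b else 0)"
        unfolding x_def using that ns(2) k_def by (intro sum.cong) (auto simp: nth_eq_iff_index_eq)
      then show ?thesis using that by simp
    qed
    have "\<forall>v\<in>set vs. sum x (N v) = 0"
    proof
      fix v assume v: "v \<in> set vs"
      then obtain a where a: "a < k" "ns ! a = N v"
        using ns(1) k_def by (metis imageI in_set_conv_nth)
      have "0 = (F *\<^sub>v (E *\<^sub>v z)) $ a" using FEz a by simp
      also have "\<dots> = (\<Sum>j<n. of_bool (vs ! j \<in> N v) * x (vs ! j))"
        using a F E x_nth
        by (subst index_mult_mat_vec)
          (auto simp: F_def scalar_prod_def lessThan_atLeast0 simp del: index_mult_mat_vec)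
      also have "\<dots> = (\<Sum>w\<in>set vs. of_bool (w \<in> N v) * x w)"
        unfolding n_def by (rule sum_nth_distinct[OF vs])
      also have "\<dots> = sum x (N v)"
        using N[OF v] by (intro sum.mono_neutral_cong_right) auto
      finally show "sum x (N v) = 0" by simp
    qed
    then have zero: "\<forall>u\<in>set vs. sum x {w \<in> set vs. N w = N u} = 0" by (rule ker)
    show "z = 0\<^sub>v k"
    proof (rule eq_vecI)
      fix a assume "a < dim_vec (0\<^sub>v k :: real vec)"
      then have a: "a < k" by simp
      then obtain u where u: "u \<in> set vs" "ns ! a = N u"
        using ns(1) k_def by (metis imageE nth_mem)
      have "sum x {w \<in> set vs. N w = N u} = (\<Sum>w\<in>{w \<in> set vs. N w = N u}. z $ a)"
        using x_class a u by (intro sum.cong) auto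
      then have "real (card {w \<in> set vs. N w = N u}) * z $ a = 0"
        using zero u by simp
      moreover have "card {w \<in> set vs. N w = N u} \<noteq> 0" using u by auto
      ultimately show "z $ a = 0\<^sub>v k $ a" using a by simp
    qed (use z in auto)
  qed
  then have "order e (char_poly (E * F + e \<cdot>\<^sub>m 1\<^sub>m n)) + k = n"
    by (rule order_char_poly_sylvester[OF E F])
  then show ?thesis unfolding EF by (simp add: k n_def)
qed

section \<open>Maximal twin sets as fibres of the neighbourhood map\<close>

lemma maximal_twin_set_iff:
  assumes "finite (pverts G)"
  shows "twin_set N G S \<and> (\<forall>T. twin_set N G T \<and> S \<subseteq> T \<longrightarrow> T = S) \<longleftrightarrow>
    card S > 1 \<and> (\<exists>u\<in>pverts G. S = {w \<in> pverts G. N w = N u})" (is "?L \<longleftrightarrow> ?R")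
proof
  assume ?L
  then have tw: "twin_set N G S" and mx: "\<And>T. twin_set N G T \<Longrightarrow> S \<subseteq> T \<Longrightarrow> T = S"
    by blast+
  then obtain u where u: "u \<in> S"
    unfolding twin_set_def by (metis card.empty ex_in_conv not_one_less_zero)
  let ?T = "{w \<in> pverts G. N w = N u}"
  have S: "S \<subseteq> ?T" "card S > 1" "u \<in> pverts G"
    using tw u unfolding twin_set_def by blast+
  \<comment> \<open>Finiteness matters here, as \<open>card\<close> of an infinite set is 0.\<close>
  have "card S \<le> card ?T"
    using S(1) assms by (intro card_mono) auto
  then have "twin_set N G ?T"
    using S(2) unfolding twin_set_def by simp
  from mx[OF this S(1)] show ?R using S by auto
next
  assume ?R
  then obtain u where u: "card S > 1" "u \<in> pverts G" "S = {w \<in> pverts G. N w = N u}" by blast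
  have "T = S" if T: "twin_set N G T" "S \<subseteq> T" for T
  proof -
    have "u \<in> T" using T(2) u by auto
    then show ?thesis using T u unfolding twin_set_def by blast
  qed
  moreover have "twin_set N G S"
    using u(1) unfolding twin_set_def u(3) by simp
  ultimately show ?L by simp
qed

text \<open>Singleton fibres of \<open>N\<close> would contribute zero, so all fibres may be summed.
  They are nonempty, so the truncated subtraction is exact, and their sizes add up to the number of
  vertices.\<close>

lemma sum_maximal_twin_sets:
  assumes fin: "finite (pverts G)"
  shows "(\<Sum>S | twin_set N G S \<and> (\<forall>T. twin_set N G T \<and> S \<subseteq> T \<longrightarrow> T = S). card S - 1) +
    card (N ` pverts G) = card (pverts G)"
proof -
  let ?V = "pverts G"
  define K where "K m = {w \<in> ?V. N w = m}" for m
  have K: "card (K m) \<ge> 1" if "m \<in> N ` ?V" for m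
  proof -
    have "K m \<noteq> {}" "finite (K m)" using that fin unfolding K_def by auto
    then show ?thesis by (simp add: Suc_leI card_gt_0_iff)
  qed
  have inj: "inj_on K (N ` ?V)"
    unfolding K_def by (rule inj_onI) blast
  have "(\<Sum>S | twin_set N G S \<and> (\<forall>T. twin_set N G T \<and> S \<subseteq> T \<longrightarrow> T = S). card S - 1) =
      (\<Sum>S | card S > 1 \<and> S \<in> K ` N ` ?V. card S - 1)"
    unfolding maximal_twin_set_iff[OF fin] K_def by (rule sum.cong) auto
  also have "\<dots> = (\<Sum>S\<in>K ` N ` ?V. card S - 1)"
    using fin by (intro sum.mono_neutral_left) auto
  also have "\<dots> = (\<Sum>m\<in>N ` ?V. card (K m) - 1)"
    using inj by (simp add: sum.reindex)
  also have "(\<Sum>m\<in>N ` ?V. card (K m) - 1) + card (N ` ?V) = (\<Sum>m\<in>N ` ?V. card (K m) - 1 + 1)"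
    unfolding sum.distrib by simp
  also have "\<dots> = (\<Sum>m\<in>N ` ?V. card (K m))"
    using K by (intro sum.cong refl) (metis le_add_diff_inverse2)
  also have "\<dots> = card ?V"
    unfolding K_def using fin card_eq_sum sum.group[of ?V "N ` ?V" N "\<lambda>_. 1::nat"] by simp
  finally show ?thesis .
qed

text \<open>Serves adjacency with \<open>e = 0\<close> and adjacency plus loops with
  \<open>e = - 1\<close>. By \<open>ne\<close> no class has empty neighbourhood, the case left out
  by the class condition of \<open>balanced\<close> for \<open>c = 0\<close>.\<close>

lemma order_char_poly_P4_free:
  fixes N :: "'a \<Rightarrow> 'a set" and A :: "real mat"
  assumes vs: "distinct vs" "set vs = pverts G"
    and sym: "symp R" and free: "P4_free (pverts G) R"
    and N: "\<And>v. v \<in> pverts G \<Longrightarrow> N v = nbhd (pverts G) R v"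
    and ne: "\<And>v. v \<in> pverts G \<Longrightarrow> N v \<noteq> {}"
    and A: "A \<in> carrier_mat (length vs) (length vs)"
    and A_nth: "\<And>i j. i < length vs \<Longrightarrow> j < length vs \<Longrightarrow>
      A $$ (i, j) = of_bool (R (vs ! i) (vs ! j)) + (if i = j then e else 0)"
  shows "order e (char_poly A) =
    (\<Sum>S | twin_set N G S \<and> (\<forall>T. twin_set N G T \<and> S \<subseteq> T \<longrightarrow> T = S). card S - 1)"
proof -
  let ?V = "pverts G"
  have fin: "finite ?V" using vs by (metis List.finite_set)
  have "sum x {w \<in> ?V. N w = N u} = 0"
    if x: "\<forall>v\<in>?V. sum x (N v) = 0" and u: "u \<in> ?V" for x :: "'a \<Rightarrow> real" and u
  proof -
    have bal: "balanced ?V R"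
      using P4_free_balanced fin sym free u by blast
    have "\<forall>v\<in>?V. sum x (nbhd ?V R v) = 0"
      using x N by simp
    then have "sum x (twins ?V (nbhd ?V R) u) = 0"
      using bal[unfolded balanced_def, rule_format, of x 0] ne[OF u] u N[OF u] by simp
    moreover have "twins ?V N u = twins ?V (nbhd ?V R) u"
      by (rule twins_restrict[of _ _ "{}"]) (use N u in auto)
    ultimately show ?thesis by (simp only:)
  qed
  then have "order e (char_poly A) + card (N ` ?V) = length vs"
    unfolding vs(2)[symmetric]
  proof (intro order_char_poly_twins[OF vs(1) A])
    show "A $$ (i, j) = of_bool (vs ! j \<in> N (vs ! i)) + (if i = j then e else 0)"
      if "i < length vs" "j < length vs" for i j
      using A_nth[OF that] N[of "vs ! i"] nth_mem[OF that(1)] nth_mem[OF that(2)] vs(2) by simp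
  qed (use N vs(2) in auto)
  then show ?thesis
    using sum_maximal_twin_sets[OF fin, of N] distinct_card[OF vs(1)] vs(2) by simp
qed

section \<open>From induced subgraphs to the relation, and the theorem\<close>

lemma cograph_P4_free:
  assumes "cograph G"
  shows "P4_free (pverts G) (\<lambda>u v. (u, v) \<in> parcs G)"
  unfolding P4_free_def
proof (safe, goal_cases)
  case (1 a b c d)
  interpret pair_graph G using assms unfolding cograph_def by blast
  have sym: "(v, u) \<in> parcs G \<longleftrightarrow> (u, v) \<in> parcs G" for u v
    using arcs_symmetric by blast
  have loopfree: "(u, u) \<notin> parcs G" for u
    using pair_no_loops by force
  have adj: "(b, a) \<in> parcs G" "(c, b) \<in> parcs G" "(d, c) \<in> parcs G"
    "(c, a) \<notin> parcs G" "(d, a) \<notin> parcs G" "(d, b) \<notin> parcs G"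
    using 1 sym by blast+
  have arcs: "{e \<in> parcs G. fst e \<in> {a, b, c, d} \<and> snd e \<in> {a, b, c, d}} =
    {(a, b), (b, a), (b, c), (c, b), (c, d), (d, c)}"
    (is "?L = ?R")
  proof
    show "?L \<subseteq> ?R"
    proof
      fix e assume "e \<in> ?L"
      then obtain u v where "e = (u, v)" "(u, v) \<in> parcs G" "u \<in> {a, b, c, d}" "v \<in> {a, b, c, d}"
        by (cases e) simp
      then show "e \<in> ?R"
        using 1 adj loopfree by (elim insertE emptyE) simp_all
    qed
    show "?R \<subseteq> ?L" using 1 adj by simp
  qed
  \<comment> \<open>\<open>f\<close> sends vertex \<open>i\<close> of \<open>path4\<close> to entry
    \<open>i\<close> of the path found in \<open>G\<close>; arcs, being pairs, are mapped
    componentwise.\<close>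
  define f where "f i = [a, b, c, d] ! i" for i
  define h where "h = \<lparr>iso_verts = f, iso_arcs = map_prod f f,
    iso_head = (snd :: 'a \<times> 'a \<Rightarrow> 'a), iso_tail = fst\<rparr>"
  let ?H = "induce_subgraph (with_proj G) {a, b, c, d}"
  have f: "f 0 = a" "f 1 = b" "f (Suc 0) = b" "f 2 = c" "f 3 = d"
    unfolding f_def by (simp_all add: numeral_eq_Suc)
  have inj: "inj_on f {0, 1, 2, 3}"
    using 1 f unfolding inj_on_def by auto
  have "wf_digraph (with_proj path4)"
    by unfold_locales (auto simp: path4_def)
  moreover have "inj_on (map_prod f f) (parcs path4)"
    by (rule inj_on_subset[OF map_prod_inj_on[OF inj inj]]) (auto simp: path4_def)
  ultimately have "pre_digraph.digraph_isomorphism (with_proj path4) h"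
    using inj unfolding pre_digraph.digraph_isomorphism_def h_def by (auto simp: path4_def)
  moreover have "?H = app_iso h (with_proj path4)"
  proof (rule pre_digraph.equality)
    show "arcs ?H = arcs (app_iso h (with_proj path4))"
      using arcs f by (simp add: h_def path4_def)
  qed (use f in \<open>auto simp: h_def path4_def\<close>)
  ultimately have "digraph_iso (with_proj path4) ?H"
    unfolding digraph_iso_def by blast
  moreover have "induced_subgraph ?H (with_proj G)"
    using 1 by (intro induced_induce) auto
  ultimately show False
    using assms unfolding cograph_def by blast
qed

lemma eig_mult_eq_0_iff:
  assumes "A \<in> carrier_mat n n"
  shows "eig_mult e A = 0 \<longleftrightarrow> \<not> eigenvalue A e"
  using degree_monic_char_poly[OF assms] eigenvalue_root_char_poly[OF assms, of e]
  unfolding eig_mult_def by (auto simp: order_root)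

lemma no_twin_set:
  assumes "\<not> (\<exists>u \<in> pverts G. \<exists>v \<in> pverts G. u \<noteq> v \<and> N u = N v)"
  shows "\<not> twin_set N G S"
proof
  assume S: "twin_set N G S"
  then have "card S > 1" unfolding twin_set_def by blast
  then obtain u v where "u \<in> S" "v \<in> S" "u \<noteq> v"
    by (metis One_nat_def card_le_Suc0_iff_eq card.infinite not_less not_one_less_zero)
  then show False using S assms unfolding twin_set_def by blast
qed

text \<open>The one-vertex graph has eigenvalue 0 but no duplication class; hence both claims on 0
  assume that no vertex is isolated.\<close>

theorem theorem4p4:
  fixes G :: "'a pair_pre_digraph" and vs :: "'a list"
  assumes "cograph G"
    and "distinct vs" and "set vs = pverts G"
  shows "((\<forall>v \<in> pverts G. open_nbhd G v \<noteq> {}) \<longrightarrow>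
            eig_mult 0 (adjacency_mat G vs) = (\<Sum>C | duplication_class G C. card C - 1) \<and>
            (\<not> (\<exists>u \<in> pverts G. \<exists>v \<in> pverts G. u \<noteq> v \<and> open_nbhd G u = open_nbhd G v) \<longrightarrow>
               \<not> eigenvalue (adjacency_mat G vs) 0)) \<and>
         eig_mult (- 1) (adjacency_mat G vs) = (\<Sum>D | coduplication_class G D. card D - 1) \<and>
         (\<not> (\<exists>u \<in> pverts G. \<exists>v \<in> pverts G. u \<noteq> v \<and> closed_nbhd G u = closed_nbhd G v) \<longrightarrow>
            \<not> eigenvalue (adjacency_mat G vs) (- 1))"
proof -
  interpret pair_graph G using assms(1) unfolding cograph_def by blast
  let ?A = "adjacency_mat G vs" and ?V = "pverts G"
  let ?arc = "\<lambda>u v. (u, v) \<in> parcs G"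
  let ?loop = "\<lambda>u v. u = v \<or> (u, v) \<in> parcs G"
  have A: "?A \<in> carrier_mat (length vs) (length vs)"
    unfolding adjacency_mat_def by simp
  have sym: "symp ?arc" "symp ?loop"
    using arcs_symmetric by (auto intro!: sympI)
  have loopfree: "(u, u) \<notin> parcs G" for u
    using pair_no_loops by force
  have free: "P4_free ?V ?arc"
    using cograph_P4_free[OF assms(1)] .
  \<comment> \<open>\<open>P4_free\<close> only tests distinct vertices, so loops change
    nothing.\<close>
  then have free': "P4_free ?V ?loop"
    unfolding P4_free_def by auto
  have "eig_mult 0 ?A = (\<Sum>C | duplication_class G C. card C - 1)"
    if "\<forall>v\<in>?V. open_nbhd G v \<noteq> {}"
    unfolding eig_mult_def duplication_class_def
    by (rule order_char_poly_P4_free[OF assms(2,3) sym(1) free])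
      (use that A in \<open>auto simp: open_nbhd_def adjacency_mat_def\<close>)
  \<comment> \<open>Neighbourhoods under \<open>?loop\<close> are the closed ones, never empty; on
    the diagonal the loop entry 1 cancels against \<open>e = - 1\<close>.\<close>
  moreover have "eig_mult (- 1) ?A = (\<Sum>D | coduplication_class G D. card D - 1)"
    unfolding eig_mult_def coduplication_class_def
    by (rule order_char_poly_P4_free[OF assms(2,3) sym(2) free'])
      (use A loopfree assms(2) in
        \<open>auto simp: closed_nbhd_def open_nbhd_def adjacency_mat_def nth_eq_iff_index_eq\<close>)
  moreover have "\<not> duplication_class G C"
    if "\<not> (\<exists>u\<in>?V. \<exists>v\<in>?V. u \<noteq> v \<and> open_nbhd G u = open_nbhd G v)" for C
    using no_twin_set[OF that] unfolding duplication_class_def by blast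
  moreover have "\<not> coduplication_class G D"
    if "\<not> (\<exists>u\<in>?V. \<exists>v\<in>?V. u \<noteq> v \<and> closed_nbhd G u = closed_nbhd G v)" for D
    using no_twin_set[OF that] unfolding coduplication_class_def by blast
  \<comment> \<open>Without twins the sums are empty, so the multiplicities are zero.\<close>
  ultimately show ?thesis
    unfolding eig_mult_eq_0_iff[OF A, symmetric] by simp
qed

end
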